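(* Let $a,b$ be nonzero real numbers and consider the system of difference equations $$u_{n+2}=\omega_1:=\frac{u_n}{a+u_nv_{n+1}},\qquad v_{n+2}=\omega_2:=\frac{v_n}{b+v_nu_{n+1}}\qquad(n\ge 0).$$ Let $Q_1(n,\cdot),Q_2(n,\cdot):\mathbb{R}\to\mathbb{R}$, $n\ge0$, be twice continuously differentiable functions. Then $Q_1=Q_1(n,u_n)$ and $Q_2=Q_2(n,v_n)$ are the characteristics of a Lie point symmetry of the system, i.e. satisfy the linearized symmetry condition $$Q_1(n+2,\omega_1)-\frac{a\,Q_1(n,u_n)}{(a+u_nv_{n+1})^2}+\frac{u_n^2\,Q_2(n+1,v_{n+1})}{(a+u_nv_{n+1})^2}=0,$$ $$Q_2(n+2,\omega_2)-\frac{b\,Q_2(n,v_n)}{(b+v_nu_{n+1})^2}+\frac{v_n^2\,Q_1(n+1,u_{n+1})}{(b+v_nu_{n+1})^2}=0$$ for all $n\ge0$ and all real $u_n,v_n,u_{n+1},v_{n+1}$ with $a+u_nv_{n+1}\ne0$ and $b+v_nu_{n+1}\neq0$, if and only if there are real constants $C_1,C_2$ such that, for all $n\ge 0$, $$Q_1(n,u_n)=\bigl(C_2(-1)^n-C_1\bigr)u_n,\qquad Q_2(n,v_n)=\bigl(C_1+C_2(-1)^n\bigr)v_n .$$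
   Context: In the linearized symmetry condition, $u_n,v_n,u_{n+1},v_{n+1}$ are treated as independent real variables, and $\omega_1,\omega_2$ denote the right-hand sides of the system as functions of these variables. *)

theory Defs
  imports "HOL-Analysis.Analysis"
begin

definition C2_function :: "(real \<Rightarrow> real) \<Rightarrow> bool" where
  "C2_function f \<longleftrightarrow> f differentiable_on UNIV \<and> deriv f C1_differentiable_on UNIV"

(* In omega1 and omega2 the variables stand for
   u = u_n, v = v_n, u' = u_(n+1), v' = v_(n+1). *)

definition omega1 :: "real \<Rightarrow> real \<Rightarrow> real \<Rightarrow> real" where
  "omega1 a u v' = u / (a + u * v')"

definition omega2 :: "real \<Rightarrow> real \<Rightarrow> real \<Rightarrow> real" where
  "omega2 b v u' = v / (b + v * u')"

(* The coefficients a / (a + u v')^2 and - u^2 / (a + u v')^2 are the partial derivatives of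
   omega1 with respect to u and v'; similarly for omega2. Both equations are required only
   where both right-hand sides of the system are defined. *)
definition linearized_symmetry_condition ::
    "real \<Rightarrow> real \<Rightarrow> (nat \<Rightarrow> real \<Rightarrow> real) \<Rightarrow> (nat \<Rightarrow> real \<Rightarrow> real) \<Rightarrow> bool" where
  "linearized_symmetry_condition a b Q1 Q2 \<longleftrightarrow>
     (\<forall>n u v u' v'. a + u * v' \<noteq> 0 \<longrightarrow> b + v * u' \<noteq> 0 \<longrightarrow>
        Q1 (n + 2) (omega1 a u v') - a * Q1 n u / (a + u * v')\<^sup>2
          + u\<^sup>2 * Q2 (n + 1) v' / (a + u * v')\<^sup>2 = 0 \<and>
        Q2 (n + 2) (omega2 b v u') - b * Q2 n v / (b + v * u')\<^sup>2
          + v\<^sup>2 * Q1 (n + 1) u' / (b + v * u')\<^sup>2 = 0)"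

end

theory Submission
  imports Defs
begin

text \<open>
  Each of the two equations has the form
  \<open>F (u/(a+uw)) (a+uw)\<^sup>2 = a f u - u\<^sup>2 g w\<close>. Eliminating \<open>F\<close> by means of the case \<open>w = 0\<close> and
  substituting \<open>t = 1/u\<close>, \<open>k t = t\<^sup>2 f (1/t)\<close> turns it into the Pexider equation
  \<open>k (t + w/a) = k t + (g 0 - g w)/a\<close>. Hence \<open>g\<close> is affine, and \<open>f\<close>, \<open>F\<close> are quadratic polynomials
  vanishing at \<open>0\<close>. As every characteristic with positive index plays the role of \<open>g\<close> in one equation
  and that of \<open>f\<close> in the other, both are linear, with coefficients governed by a two-term recurrence;
  linearity at index \<open>0\<close> follows from linearity at index \<open>2\<close> through \<open>F\<close>.
\<close>

text \<open>Additivity turns a translate of \<open>G\<close> into \<open>G\<close> plus a constant,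
  so the derivative \<open>c\<close> at 0 is the derivative everywhere and
  \<open>G x - c * x\<close> is constant.\<close>

lemma additive_differentiable_imp_linear:
  fixes G :: "real \<Rightarrow> real"
  assumes add: "\<And>x y. G (x + y) = G x + G y" and diff: "G differentiable (at 0)"
  obtains c where "\<And>x. G x = c * x"
proof -
  from diff obtain c where c: "(G has_real_derivative c) (at 0)"
    by (auto simp: real_differentiable_def)
  have "(G has_real_derivative c) (at x)" for x
  proof -
    have "((\<lambda>y. G y + G x) has_real_derivative c) (at 0)"
      by (auto intro!: derivative_eq_intros c)
    then have "((\<lambda>y. G (y + x)) has_real_derivative c) (at 0)"
      by (simp add: add)
    then show ?thesis
      using DERIV_shift[of G c 0 x] by simp
  qed
  then have "((\<lambda>x. G x - c * x) has_real_derivative 0) (at x)" for x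
    by (auto intro!: derivative_eq_intros)
  then have "G x - c * x = G 0 - c * 0" for x
    using DERIV_isconst_all[of "\<lambda>x. G x - c * x" x 0] by blast
  moreover have "G 0 = 0"
    using add[of 0 0] by simp
  ultimately show ?thesis
    using that[of c] by simp
qed

lemma linearized_equation_solution:
  fixes a :: real and F f g :: "real \<Rightarrow> real"
  assumes a: "a \<noteq> 0"
    and eq: "\<And>u w. a + u * w \<noteq> 0 \<Longrightarrow>
      F (u / (a + u * w)) - a * f u / (a + u * w)\<^sup>2 + u\<^sup>2 * g w / (a + u * w)\<^sup>2 = 0"
    and cont: "isCont f 0" and diff: "g differentiable (at 0)"
  obtains m k where "\<And>x. f x = m * x + k * x\<^sup>2" "\<And>w. g w = g 0 - m * w"
    "\<And>x. F x = m * x + (a * k - g 0) * x\<^sup>2"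
proof -
  define G where "G w = g 0 - g w" for w
  have F: "F x = f (a * x) / a - x\<^sup>2 * g 0" for x
    using eq[of "a * x" 0] a by (simp add: field_simps power2_eq_square)
  define k where "k t = t\<^sup>2 * f (1 / t)" for t
  have k: "k (t + w / a) = k t + G w / a" if t: "t \<noteq> 0" and s: "t + w / a \<noteq> 0" for t w
  proof -
    \<comment> \<open>With \<open>u = 1 / t\<close> the denominator \<open>a + u * w\<close> equals
      \<open>s / t\<close>, so the argument of \<open>F\<close> becomes
      \<open>1 / s\<close>.\<close>
    define s where "s = a * (t + w / a)"
    have s0: "s \<noteq> 0" using s a by (simp add: s_def)
    have ds: "a + 1 / t * w = s / t"
      using t a by (simp add: s_def field_simps)
    have "F (1 / s) - a * f (1 / t) * t\<^sup>2 / s\<^sup>2 + g w / s\<^sup>2 = 0"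
      using eq[of "1 / t" w] s0 t unfolding ds by (simp add: power_divide)
    then have "s\<^sup>2 * (F (1 / s) - a * f (1 / t) * t\<^sup>2 / s\<^sup>2 + g w / s\<^sup>2) = 0"
      by simp
    then have "f (a / s) * s\<^sup>2 / a - g 0 - a * f (1 / t) * t\<^sup>2 + g w = 0"
      using s0 unfolding F by (simp add: algebra_simps power_divide)
    moreover have "k (t + w / a) = s\<^sup>2 / a\<^sup>2 * f (a / s)"
    proof -
      have "t + w / a = s / a" using a by (simp add: s_def)
      then show ?thesis by (simp add: k_def power_divide)
    qed
    ultimately show ?thesis
      using a unfolding k_def G_def by (simp add: field_simps power2_eq_square)
  qed
  have "G (p + q) = G p + G q" for p q
  proof -
    obtain t where t: "t \<notin> {0, - p / a, - (p + q) / a}"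
      using ex_new_if_finite[OF infinite_UNIV_char_0, of "{0, - p / a, - (p + q) / a}"] by auto
    have nz: "t \<noteq> 0" "t + p / a \<noteq> 0" "t + p / a + q / a \<noteq> 0" "t + (p + q) / a \<noteq> 0"
      using t a by (simp_all add: field_simps)
    have "k (t + p / a + q / a) = k (t + (p + q) / a)"
      by (simp add: add_divide_distrib add.assoc)
    then have "k t + G p / a + G q / a = k t + G (p + q) / a"
      using k[of t p] k[of "t + p / a" q] k[of t "p + q"] nz by simp
    then show ?thesis
      using a by (simp add: field_simps)
  qed
  moreover have "G differentiable (at 0)"
    unfolding G_def by (intro derivative_intros diff)
  ultimately obtain m where m: "\<And>w. G w = m * w"
    using additive_differentiable_imp_linear by blast
  \<comment> \<open>Since \<open>G\<close> is linear, \<open>k t = m * t + k0\<close> for nonzero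
    \<open>t\<close>; \<open>t = 1\<close> gives \<open>k0\<close>. The shift from 1 to
    \<open>1 / x\<close> then yields \<open>f x\<close>.\<close>
  define k0 where "k0 = f 1 - m"
  have f_nz: "f x = m * x + k0 * x\<^sup>2" if "x \<noteq> 0" for x
  proof -
    have "f x / x\<^sup>2 = f 1 + m * (1 / x - 1)"
      using k[of 1 "a * (1 / x - 1)"] that a by (simp add: k_def m power_divide)
    then show ?thesis
      using that by (simp add: k0_def field_simps power2_eq_square)
  qed
  \<comment> \<open>The substitution \<open>t = 1 / x\<close> never reaches \<open>x = 0\<close>;
    continuity supplies the value there.\<close>
  have "f 0 = 0"
  proof -
    have "(f \<longlongrightarrow> f 0) (at 0)"
      using cont by (simp add: isCont_def)
    moreover have "(f \<longlongrightarrow> m * 0 + k0 * 0\<^sup>2) (at 0)"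
    proof (rule Lim_transform_eventually)
      show "((\<lambda>x. m * x + k0 * x\<^sup>2) \<longlongrightarrow> m * 0 + k0 * 0\<^sup>2) (at 0)"
        by (intro tendsto_intros)
      show "\<forall>\<^sub>F x in at 0. m * x + k0 * x\<^sup>2 = f x"
        using f_nz by (auto simp: eventually_at_filter)
    qed
    ultimately show ?thesis
      using tendsto_unique[of "at (0::real)"] by fastforce
  qed
  then have f: "f x = m * x + k0 * x\<^sup>2" for x
    by (cases "x = 0") (simp_all add: f_nz)
  show thesis
  proof (rule that[OF f])
    show "g w = g 0 - m * w" for w
      using m[of w] by (simp add: G_def)
    show "F x = m * x + (a * k0 - g 0) * x\<^sup>2" for x
      unfolding F f using a by (simp add: field_simps power2_eq_square)
  qed
qed

lemma quadratic_eq_affine_coeffs: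
  fixes m k c d :: real
  assumes "\<And>x. m * x + k * x\<^sup>2 = c + d * x"
  shows "k = 0" "c = 0" "m = d"
  using assms[of 0] assms[of 1] assms[of "-1"] by simp_all

text \<open>A step in \<open>n\<close> exchanges the two coefficients and flips their signs, so two
  steps restore them. Both equations thus become
  \<open>p * u * s - c * p * u - p * u\<^sup>2 * w = 0\<close> with \<open>s = c + u * w\<close>,
  where \<open>c\<close> is \<open>a\<close> or \<open>b\<close>.\<close>

lemma linearized_symmetry_condition_linear:
  fixes a b C1 C2 :: real
  assumes Q1: "\<And>n u. Q1 n u = (C2 * (-1) ^ n - C1) * u"
    and Q2: "\<And>n v. Q2 n v = (C1 + C2 * (-1) ^ n) * v"
  shows "linearized_symmetry_condition a b Q1 Q2"
proof -
  have *: "p * (u / s) - c * (p * u) / s\<^sup>2 + u\<^sup>2 * (- p * w) / s\<^sup>2 = 0"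
    if "s = c + u * w" "s \<noteq> 0" for p u s c w :: real
  proof -
    have "p * (u / s) = p * u * s / s\<^sup>2"
      using that(2) by (simp add: power2_eq_square)
    moreover have "p * u * s - c * (p * u) + u\<^sup>2 * (- p * w) = 0"
      by (simp add: that(1) algebra_simps power2_eq_square)
    ultimately show ?thesis
      by (metis add_divide_distrib diff_divide_distrib div_0)
  qed
  show ?thesis
    unfolding linearized_symmetry_condition_def omega1_def omega2_def
  proof (intro allI impI conjI)
    fix n and u v u' v' :: real
    define p q where "p = C2 * (-1) ^ n - C1" and "q = C1 + C2 * (-1) ^ n"
    have Q: "Q1 n x = p * x" "Q1 (n + 2) x = p * x" "Q1 (n + 1) x = - q * x"
      "Q2 n x = q * x" "Q2 (n + 2) x = q * x" "Q2 (n + 1) x = - p * x" for x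
      by (simp_all add: Q1 Q2 p_def q_def algebra_simps)
    assume "a + u * v' \<noteq> 0" "b + v * u' \<noteq> 0"
    then show "Q1 (n + 2) (u / (a + u * v')) - a * Q1 n u / (a + u * v')\<^sup>2
          + u\<^sup>2 * Q2 (n + 1) v' / (a + u * v')\<^sup>2 = 0"
      and "Q2 (n + 2) (v / (b + v * u')) - b * Q2 n v / (b + v * u')\<^sup>2
          + v\<^sup>2 * Q1 (n + 1) u' / (b + v * u')\<^sup>2 = 0"
      unfolding Q by (intro *; simp)+
  qed
qed

lemma linearized_symmetry_condition_imp_linear:
  fixes a b :: real
  assumes a: "a \<noteq> 0" and b: "b \<noteq> 0"
    and diff1: "\<And>n. Q1 n differentiable (at 0)" and diff2: "\<And>n. Q2 n differentiable (at 0)"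
    and L: "linearized_symmetry_condition a b Q1 Q2"
  obtains C1 C2 :: real where "\<And>n u. Q1 n u = (C2 * (-1) ^ n - C1) * u"
    "\<And>n v. Q2 n v = (C1 + C2 * (-1) ^ n) * v"
proof -
  have cont: "isCont (Q1 n) 0" "isCont (Q2 n) 0" for n
    using diff1 diff2 by (auto intro: differentiable_imp_continuous_within)
  have "\<exists>m k. (\<forall>x. Q1 n x = m * x + k * x\<^sup>2) \<and> (\<forall>w. Q2 (n + 1) w = Q2 (n + 1) 0 - m * w)
      \<and> (\<forall>x. Q1 (n + 2) x = m * x + (a * k - Q2 (n + 1) 0) * x\<^sup>2)" for n
  proof (rule linearized_equation_solution[OF a _ cont(1) diff2, of "Q1 (n + 2)" n "n + 1"])
    show "Q1 (n + 2) (u / (a + u * w)) - a * Q1 n u / (a + u * w)\<^sup>2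
        + u\<^sup>2 * Q2 (n + 1) w / (a + u * w)\<^sup>2 = 0" if "a + u * w \<noteq> 0" for u w
      \<comment> \<open>Setting the variables of the other equation to 0 makes its denominator
        \<open>b\<close>, which is nonzero, so this equation holds under its own side condition
        alone.\<close>
      using L[unfolded linearized_symmetry_condition_def omega1_def, rule_format, of u w 0 0 n]
        that b by simp
  qed blast
  then obtain m k where mk: "\<And>n x. Q1 n x = m n * x + k n * x\<^sup>2"
    "\<And>n w. Q2 (n + 1) w = Q2 (n + 1) 0 - m n * w"
    "\<And>n x. Q1 (n + 2) x = m n * x + (a * k n - Q2 (n + 1) 0) * x\<^sup>2"
    by metis
  have "\<exists>m k. (\<forall>x. Q2 n x = m * x + k * x\<^sup>2) \<and> (\<forall>w. Q1 (n + 1) w = Q1 (n + 1) 0 - m * w)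
      \<and> (\<forall>x. Q2 (n + 2) x = m * x + (b * k - Q1 (n + 1) 0) * x\<^sup>2)" for n
  proof (rule linearized_equation_solution[OF b _ cont(2) diff1, of "Q2 (n + 2)" n "n + 1"])
    show "Q2 (n + 2) (u / (b + u * w)) - b * Q2 n u / (b + u * w)\<^sup>2
        + u\<^sup>2 * Q1 (n + 1) w / (b + u * w)\<^sup>2 = 0" if "b + u * w \<noteq> 0" for u w
      using L[unfolded linearized_symmetry_condition_def omega2_def, rule_format, of 0 0 u w n]
        that a by simp
  qed blast
  then obtain m' k' where mk': "\<And>n x. Q2 n x = m' n * x + k' n * x\<^sup>2"
    "\<And>n w. Q1 (n + 1) w = Q1 (n + 1) 0 - m' n * w"
    "\<And>n x. Q2 (n + 2) x = m' n * x + (b * k' n - Q1 (n + 1) 0) * x\<^sup>2"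
    by metis
  have zero: "Q1 n 0 = 0" "Q2 n 0 = 0" for n
    using mk(1)[of n 0] mk'(1)[of n 0] by simp_all
  \<comment> \<open>\<open>Q1 (Suc n)\<close> is quadratic by the first equation at
    \<open>Suc n\<close> and affine by the second at \<open>n\<close>; coefficients are
    compared.\<close>
  have suc1: "k (Suc n) = 0" "m (Suc n) = - m' n" for n
  proof -
    have "m (Suc n) * x + k (Suc n) * x\<^sup>2 = Q1 (Suc n) 0 + - m' n * x" for x
      using mk(1)[of "Suc n" x] mk'(2)[of n x] by simp
    from quadratic_eq_affine_coeffs[OF this] show "k (Suc n) = 0" "m (Suc n) = - m' n"
      by simp_all
  qed
  have suc2: "k' (Suc n) = 0" "m' (Suc n) = - m n" for n
  proof -
    have "m' (Suc n) * x + k' (Suc n) * x\<^sup>2 = Q2 (Suc n) 0 + - m n * x" for x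
      using mk'(1)[of "Suc n" x] mk(2)[of n x] by simp
    from quadratic_eq_affine_coeffs[OF this] show "k' (Suc n) = 0" "m' (Suc n) = - m n"
      by simp_all
  qed
  \<comment> \<open>Index 0 is no successor, so \<open>Q1 2\<close> is used instead: its quadratic
    coefficient is \<open>a * k 0 - Q2 1 0\<close>, where \<open>Q2 1 0 = 0\<close>, and also
    \<open>k 2 = 0\<close>.\<close>
  have "k 0 = 0"
  proof -
    have "m 0 * x + a * k 0 * x\<^sup>2 = 0 + m 2 * x" for x
      using mk(3)[of 0 x] mk(1)[of 2 x] suc1(1)[of 1] zero(2)[of 1]
      by (simp add: numeral_2_eq_2)
    from quadratic_eq_affine_coeffs(1)[OF this] show ?thesis
      using a by simp
  qed
  moreover have "k' 0 = 0"
  proof -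
    have "m' 0 * x + b * k' 0 * x\<^sup>2 = 0 + m' 2 * x" for x
      using mk'(3)[of 0 x] mk'(1)[of 2 x] suc2(1)[of 1] zero(1)[of 1]
      by (simp add: numeral_2_eq_2)
    from quadratic_eq_affine_coeffs(1)[OF this] show ?thesis
      using b by simp
  qed
  ultimately have k: "k n = 0" "k' n = 0" for n
    by (cases n; simp add: suc1 suc2)+
  \<comment> \<open>Under the recurrence \<open>m' n - m n\<close> stays constant while
    \<open>m' n + m n\<close> changes sign at each step.\<close>
  define C1 C2 where "C1 = (m' 0 - m 0) / 2" and "C2 = (m' 0 + m 0) / 2"
  have "m n = C2 * (-1) ^ n - C1 \<and> m' n = C1 + C2 * (-1) ^ n" for n
    by (induction n) (auto simp: suc1 suc2 C1_def C2_def field_simps)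
  then show thesis
    using that[of C2 C1] mk(1) mk'(1) by (simp add: k)
qed

theorem mainTheorem3:
  fixes a b :: real and Q1 Q2 :: "nat \<Rightarrow> real \<Rightarrow> real"
  assumes "a \<noteq> 0" and "b \<noteq> 0"
    and "\<And>n. C2_function (Q1 n)" and "\<And>n. C2_function (Q2 n)"
  shows "linearized_symmetry_condition a b Q1 Q2 \<longleftrightarrow>
    (\<exists>C1 C2 :: real. \<forall>n.
       (\<forall>u. Q1 n u = (C2 * (-1) ^ n - C1) * u) \<and>
       (\<forall>v. Q2 n v = (C1 + C2 * (-1) ^ n) * v))"
proof
  assume "linearized_symmetry_condition a b Q1 Q2"
  moreover have "Q1 n differentiable (at 0)" "Q2 n differentiable (at 0)" for n
    using assms(3,4)[of n] by (auto simp: C2_function_def differentiable_on_def)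
  ultimately obtain C1 C2 :: real where "\<And>n u. Q1 n u = (C2 * (-1) ^ n - C1) * u"
    "\<And>n v. Q2 n v = (C1 + C2 * (-1) ^ n) * v"
    using linearized_symmetry_condition_imp_linear[OF assms(1,2)] by metis
  then show "\<exists>C1 C2 :: real. \<forall>n. (\<forall>u. Q1 n u = (C2 * (-1) ^ n - C1) * u) \<and>
       (\<forall>v. Q2 n v = (C1 + C2 * (-1) ^ n) * v)"
    by blast
next
  assume "\<exists>C1 C2 :: real. \<forall>n. (\<forall>u. Q1 n u = (C2 * (-1) ^ n - C1) * u) \<and>
       (\<forall>v. Q2 n v = (C1 + C2 * (-1) ^ n) * v)"
  then show "linearized_symmetry_condition a b Q1 Q2"
    using linearized_symmetry_condition_linear by metis
qed

end
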